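(* Let $(V,E,S,c)$ be a network and let $\mu$ be a directed metric on $S$. Then $$\max\{\operatorname{val}(\mu,f) : f \text{ a multiflow in } (V,E,S,c)\}=\min\Big\{\sum_{xy\in E}c(xy)\,D_\infty(\rho(x),\rho(y)) : \rho:V\to T_\mu,\ \rho(s)=\mu_s\ (s\in S)\Big\}.$$
   Context: A network $(V,E,S,c)$ consists of a (finite) directed graph $(V,E)$, a specified vertex subset $S\subseteq V$ (terminals), and a nonnegative integer-valued edge-capacity $c:E\to\mathbf{Z}_+$. An edge with tail $x$ and head $y$ is denoted $xy$. An $S$-path is a directed path in $(V,E)$ connecting distinct terminals in $S$. A multiflow is a pair $f=(\mathcal{P},\lambda)$ of a set $\mathcal{P}$ of $S$-paths and a function $\lambda:\mathcal{P}\to\mathbf{R}_+$ such that $\sum\{\lambda(P) : P\in\mathcal{P},\ P\text{ contains }e\}\le c(e)$ for all $e\in E$. Its value is $\operatorname{val}(\mu,f)=\sum_{P\in\mathcal{P}}\mu(s_P,t_P)\lambda(P)$, where $s_P$, $t_P$ are the starting and end vertices of $P$. A directed metric on $S$ is a function $\mu:S\times S\to\mathbf{R}_+$ with $\mu(x,x)=0$ and $\mu(x,y)+\mu(y,z)\ge\mu(x,z)$ for all $x,y,z$ (not necessarily symmetric). Let $S^c,S^r$ be two disjoint copies of $S$, with $s^c\in S^c$, $s^r\in S^r$ the copies of $s\in S$, and $S^{cr}=S^c\cup S^r$. For $p\in\mathbf{R}^{S^{cr}}$, $p^c$ and $p^r$ are its restrictions to $S^c$ and $S^r$. Let $P_\mu=\{p\in\mathbf{R}_+^{S^{cr}}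 : p(s^c)+p(t^r)\ge\mu(s,t)\ \forall s,t\in S\}$, and let $T_\mu$ be the set of minimal elements of $P_\mu$ (points $p\in P_\mu$ for which no $q\in P_\mu$, $q\ne p$, satisfies $q\le p$ coordinatewise). For $p,q\in\mathbf{R}^X$ ($X$ finite), $D_\infty^+(p,q)=\max_{x\in X}\max\{q(x)-p(x),0\}$; for $p,q\in\mathbf{R}^{S^{cr}}$, $D_\infty(p,q)=\max\{D_\infty^+(p^c,q^c),D_\infty^+(q^r,p^r)\}$. For $s\in S$, $\mu_s\in\mathbf{R}^{S^{cr}}$ is given by $\mu_s(t^c)=\mu(t,s)$, $\mu_s(t^r)=\mu(s,t)$ $(t\in S)$. *)

theory Defs
  imports Complex_Main "HOL-Library.FuncSet" "Graph_Theory.Graph_Theory"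
begin

text \<open>
  A network is a finite digraph \<open>G\<close> (library notion; loops and parallel arcs are allowed),
  a set \<open>S\<close> of terminals and a capacity \<open>c\<close> with values in \<open>nat\<close>.
  A path is given by its list of arcs; \<open>apath\<close> requires that no vertex is repeated.
\<close>

definition S_paths :: "('v, 'e) pre_digraph \<Rightarrow> 'v set \<Rightarrow> 'e list set" where
  "S_paths G S = {P. \<exists>s\<in>S. \<exists>t\<in>S. s \<noteq> t \<and> pre_digraph.apath G s P t}"

text \<open>An \<open>S\<close>-path has at least one arc, so the next two functions give its end points.\<close>

definition start_vertex :: "('v, 'e) pre_digraph \<Rightarrow> 'e list \<Rightarrow> 'v" where
  "start_vertex G P = tail G (hd P)"

definition end_vertex :: "('v, 'e) pre_digraph \<Rightarrow> 'e list \<Rightarrow> 'v" where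
  "end_vertex G P = head G (last P)"

text \<open>
  In a finite digraph there are only finitely many \<open>S\<close>-paths, so the sums below are finite.
  Only the values of the second component on the first one matter.
\<close>

definition multiflow ::
  "('v, 'e) pre_digraph \<Rightarrow> 'v set \<Rightarrow> ('e \<Rightarrow> nat) \<Rightarrow> 'e list set \<times> ('e list \<Rightarrow> real) \<Rightarrow> bool" where
  "multiflow G S c = (\<lambda>(\<P>, l).
     \<P> \<subseteq> S_paths G S \<and> (\<forall>P\<in>\<P>. 0 \<le> l P) \<and>
     (\<forall>e\<in>arcs G. (\<Sum>P\<in>{P\<in>\<P>. e \<in> set P}. l P) \<le> real (c e)))"

definition flow_value ::
  "('v, 'e) pre_digraph \<Rightarrow> ('v \<Rightarrow> 'v \<Rightarrow> real) \<Rightarrow> 'e list set \<times> ('e list \<Rightarrow> real) \<Rightarrow> real" where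
  "flow_value G \<mu> = (\<lambda>(\<P>, l). \<Sum>P\<in>\<P>. \<mu> (start_vertex G P) (end_vertex G P) * l P)"

definition directed_metric :: "'v set \<Rightarrow> ('v \<Rightarrow> 'v \<Rightarrow> real) \<Rightarrow> bool" where
  "directed_metric S \<mu> \<longleftrightarrow>
     (\<forall>x\<in>S. \<forall>y\<in>S. 0 \<le> \<mu> x y) \<and> (\<forall>x\<in>S. \<mu> x x = 0) \<and>
     (\<forall>x\<in>S. \<forall>y\<in>S. \<forall>z\<in>S. \<mu> x z \<le> \<mu> x y + \<mu> y z)"

text \<open>
  The disjoint union of the two copies of \<open>S\<close> is \<open>S <+> S\<close>, with \<open>Inl s\<close> for the c-copy and
  \<open>Inr s\<close> for the r-copy of \<open>s\<close>. Vectors indexed by it are extensional functions, so that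
  equality of vectors is equality on \<open>S <+> S\<close>.
\<close>

definition P_set :: "'v set \<Rightarrow> ('v \<Rightarrow> 'v \<Rightarrow> real) \<Rightarrow> ('v + 'v \<Rightarrow> real) set" where
  "P_set S \<mu> = {p \<in> (S <+> S) \<rightarrow>\<^sub>E {0..}. \<forall>s\<in>S. \<forall>t\<in>S. \<mu> s t \<le> p (Inl s) + p (Inr t)}"

definition T_set :: "'v set \<Rightarrow> ('v \<Rightarrow> 'v \<Rightarrow> real) \<Rightarrow> ('v + 'v \<Rightarrow> real) set" where
  "T_set S \<mu> = {p \<in> P_set S \<mu>. \<not> (\<exists>q\<in>P_set S \<mu>. q \<noteq> p \<and> (\<forall>x\<in>S <+> S. q x \<le> p x))}"

text \<open>The inserted 0 only matters for empty \<open>X\<close>: there the maximum is read as 0.\<close>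

definition Dinf_plus :: "'a set \<Rightarrow> ('a \<Rightarrow> real) \<Rightarrow> ('a \<Rightarrow> real) \<Rightarrow> real" where
  "Dinf_plus X p q = Max (insert 0 ((\<lambda>x. max (q x - p x) 0) ` X))"

definition Dinf :: "'v set \<Rightarrow> ('v + 'v \<Rightarrow> real) \<Rightarrow> ('v + 'v \<Rightarrow> real) \<Rightarrow> real" where
  "Dinf S p q = max (Dinf_plus (Inl ` S) p q) (Dinf_plus (Inr ` S) q p)"

definition mu_point :: "'v set \<Rightarrow> ('v \<Rightarrow> 'v \<Rightarrow> real) \<Rightarrow> 'v \<Rightarrow> ('v + 'v \<Rightarrow> real)" where
  "mu_point S \<mu> s = restrict (case_sum (\<lambda>t. \<mu> t s) (\<lambda>t. \<mu> s t)) (S <+> S)"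

end

theory Submission
  imports Defs
begin

text \<open>
  The inequality "max \<open>\<le>\<close> min" is a telescoping argument. Along a path from \<open>s\<close> to \<open>t\<close> the
  coordinate of \<open>\<rho>\<close> at the c-copy of \<open>s\<close> grows from \<open>\<mu>(s,s) = 0\<close> to \<open>\<mu>(s,t)\<close>, and it grows by at most
  \<open>D\<^sub>\<infinity>(\<rho>(x), \<rho>(y))\<close> on an arc \<open>xy\<close>. Hence every admissible \<open>\<rho>\<close> gives arc lengths for which each
  \<open>S\<close>-path is at least as long as \<open>\<mu>\<close> requires (\<open>mu_le_sum_Dinf\<close>), and a weighted sum over the paths
  of a multiflow yields the inequality (\<open>flow_value_le_cost\<close>).

  For equality, linear programming duality (\<open>lp_strong_duality\<close>, derived from Farkas' lemma)
  supplies an optimal multiflow together with arc lengths \<open>l \<ge> 0\<close> of the same value for which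
  every \<open>S\<close>-path from \<open>s\<close> to \<open>t\<close> has length at least \<open>\<mu>(s,t)\<close>. It remains to realise
  \<open>l\<close> by a map into the tight span \<open>T\<^sub>\<mu>\<close> that stretches no arc beyond its length.
  Let \<open>a\<^sub>x(t)\<close> be the \<open>l\<close>-distance from \<open>x\<close> to the terminal \<open>t\<close>, cut off at a large constant.
  For vectors \<open>a\<close> on \<open>S\<close> put
  \<open>a\<^sup>*(s) = max(0, max\<^sub>t (\<mu>(s,t) - a(t)))\<close>, and define the conjugate in the other direction in the same
  way with \<open>\<mu>\<close> transposed. The two conjugations form a Galois connection, so the pair
  \<open>(a\<^sup>*, a\<^sup>*\<^sup>*)\<close> is a minimal element of \<open>P\<^sub>\<mu>\<close> (\<open>tight_point_in_T_set\<close>). Conjugation reverses the order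
  and is nonexpansive for one-sided sup-distances, so \<open>\<rho>(x) = (a\<^sub>x\<^sup>*, a\<^sub>x\<^sup>*\<^sup>*)\<close> satisfies
  \<open>D\<^sub>\<infinity>(\<rho>(x), \<rho>(y)) \<le> l(xy)\<close> (\<open>Dinf_tight_point_le\<close>). At a terminal \<open>s\<close> one has \<open>a\<^sub>s(s) = 0\<close> and
  \<open>a\<^sub>s \<ge> \<mu>(s,\<cdot>)\<close>, which with the triangle inequality for \<open>\<mu>\<close> forces \<open>\<rho>(s) = \<mu>\<^sub>s\<close>
  (\<open>tight_point_eq_mu_point\<close>).
\<close>

section \<open>Farkas' lemma and linear programming duality\<close>

text \<open>
  Bartl's argument, by induction on the number of rows. If the inequality for \<open>g\<close> does not already
  follow from the rows in \<open>I\<close>, some \<open>z\<close> satisfies those rows and violates it. The new row \<open>k\<close> is then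
  positive at \<open>z\<close>, so projecting along \<open>z\<close> onto the kernel of row \<open>k\<close> removes this row.
\<close>

lemma farkas:
  fixes A :: "'i \<Rightarrow> 'j \<Rightarrow> real"
  assumes "finite I" and J: "finite J"
    and "\<And>x. \<forall>i\<in>I. (\<Sum>j\<in>J. A i j * x j) \<le> 0 \<Longrightarrow> (\<Sum>j\<in>J. g j * x j) \<le> 0"
  shows "\<exists>u. (\<forall>i\<in>I. 0 \<le> u i) \<and> (\<forall>j\<in>J. g j = (\<Sum>i\<in>I. u i * A i j))"
  using assms(1,3)
proof (induction I arbitrary: A g rule: finite_induct)
  case empty
  have "(\<Sum>j\<in>J. g j * g j) \<le> 0"
    using empty by simp
  then have "(\<Sum>j\<in>J. g j * g j) = 0"
    by (intro antisym sum_nonneg) auto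
  then show ?case
    using J by (simp add: sum_nonneg_eq_0_iff)
next
  case (insert k I)
  show ?case
  proof (cases "\<forall>x. (\<forall>i\<in>I. (\<Sum>j\<in>J. A i j * x j) \<le> 0) \<longrightarrow> (\<Sum>j\<in>J. g j * x j) \<le> 0")
    case True
    then obtain u where "\<forall>i\<in>I. 0 \<le> u i" "\<forall>j\<in>J. g j = (\<Sum>i\<in>I. u i * A i j)"
      using insert.IH[of A g] by blast
    moreover have "(\<Sum>i\<in>I. (u(k := 0)) i * A i j) = (\<Sum>i\<in>I. u i * A i j)" for j
      using insert.hyps by (intro sum.cong) auto
    ultimately show ?thesis
      using insert.hyps by (intro exI[of _ "u(k := 0)"]) auto
  next
    case False
    then obtain z where z: "\<forall>i\<in>I. (\<Sum>j\<in>J. A i j * z j) \<le> 0" "(\<Sum>j\<in>J. g j * z j) > 0"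
      by (auto simp: not_le)
    define \<alpha> where "\<alpha> i = (\<Sum>j\<in>J. A i j * z j)" for i
    define \<gamma> where "\<gamma> = (\<Sum>j\<in>J. g j * z j)"
    have \<alpha>k: "\<alpha> k > 0"
      using insert.prems[of z] z by (force simp: \<alpha>_def)
    define A' where "A' i j = A i j - \<alpha> i / \<alpha> k * A k j" for i j
    define g' where "g' j = g j - \<gamma> / \<alpha> k * A k j" for j
    have "(\<Sum>j\<in>J. g' j * x j) \<le> 0" if x: "\<forall>i\<in>I. (\<Sum>j\<in>J. A' i j * x j) \<le> 0" for x
    proof -
      define r where "r = (\<Sum>j\<in>J. A k j * x j) / \<alpha> k"
      \<comment> \<open>\<open>r\<close> is chosen so that \<open>x'\<close>, the projection of \<open>x\<close> along \<open>z\<close>, lies in the kernel of row \<open>k\<close>.\<close>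
      define x' where "x' j = x j - r * z j" for j
      have lin: "(\<Sum>j\<in>J. a j * x' j) = (\<Sum>j\<in>J. a j * x j) - r * (\<Sum>j\<in>J. a j * z j)" for a
        by (simp add: x'_def algebra_simps sum_subtractf sum_distrib_left)
      have "(\<Sum>j\<in>J. A i j * x' j) = (\<Sum>j\<in>J. A' i j * x j)" for i
        unfolding lin A'_def r_def \<alpha>_def[symmetric]
        by (simp add: algebra_simps sum_subtractf sum_distrib_left sum_divide_distrib)
      moreover have "(\<Sum>j\<in>J. A k j * x' j) = 0"
        unfolding lin r_def \<alpha>_def[symmetric] using \<alpha>k by simp
      ultimately have "(\<Sum>j\<in>J. g j * x' j) \<le> 0"
        using x by (intro insert.prems) auto
      also have "(\<Sum>j\<in>J. g j * x' j) = (\<Sum>j\<in>J. g' j * x j)"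
        unfolding lin g'_def r_def \<gamma>_def[symmetric]
        by (simp add: algebra_simps sum_subtractf sum_distrib_left sum_divide_distrib)
      finally show ?thesis .
    qed
    then obtain u where u: "\<forall>i\<in>I. 0 \<le> u i" "\<forall>j\<in>J. g' j = (\<Sum>i\<in>I. u i * A' i j)"
      using insert.IH[of A' g'] by blast
    define w where "w = (\<gamma> - (\<Sum>i\<in>I. u i * \<alpha> i)) / \<alpha> k"
    have "(\<Sum>i\<in>I. u i * \<alpha> i) \<le> 0"
      using u z by (intro sum_nonpos mult_nonneg_nonpos) (auto simp: \<alpha>_def)
    then have w: "w \<ge> 0"
      using z(2) \<alpha>k by (auto simp: w_def \<gamma>_def)
    have "g j = w * A k j + (\<Sum>i\<in>I. u i * A i j)" if "j \<in> J" for j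
    proof -
      have "g' j = (\<Sum>i\<in>I. u i * A' i j)"
        using u(2) that by blast
      then have "g j = \<gamma> / \<alpha> k * A k j + (\<Sum>i\<in>I. u i * A' i j)"
        by (simp add: g'_def)
      also have "(\<Sum>i\<in>I. u i * A' i j) = (\<Sum>i\<in>I. u i * A i j) - (\<Sum>i\<in>I. u i * \<alpha> i) / \<alpha> k * A k j"
        by (simp add: A'_def algebra_simps sum_subtractf sum_distrib_left sum_divide_distrib)
      finally show ?thesis
        by (simp add: w_def diff_divide_distrib algebra_simps)
    qed
    moreover have "(\<Sum>i\<in>I. (u(k := w)) i * A i j) = (\<Sum>i\<in>I. u i * A i j)" for j
      using insert.hyps by (intro sum.cong) auto
    ultimately show ?thesis
      using insert.hyps u w by (intro exI[of _ "u(k := w)"]) auto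
  qed
qed

text \<open>
  Homogenise with an additional variable, indexed by \<open>None\<close>, in place of the constant 1. If the
  system has no solution, this variable is nonpositive throughout the homogeneous cone, and
  \<open>farkas\<close> turns this fact into a certificate.
\<close>

lemma farkas_alternative:
  fixes M :: "'i \<Rightarrow> 'j \<Rightarrow> real"
  assumes I: "finite I" and J: "finite J"
  shows "(\<exists>x. (\<forall>j\<in>J. 0 \<le> x j) \<and> (\<forall>i\<in>I. (\<Sum>j\<in>J. M i j * x j) \<le> b i)) \<or>
    (\<exists>u. (\<forall>i\<in>I. 0 \<le> u i) \<and> (\<forall>j\<in>J. 0 \<le> (\<Sum>i\<in>I. u i * M i j)) \<and> (\<Sum>i\<in>I. u i * b i) < 0)"
proof -
  define J' where "J' = insert None (Some ` J)"
  define A where "A = case_sum (\<lambda>i. case_option (- b i) (M i)) (\<lambda>w v. if v = w then - 1 else 0)"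
  define g :: "'j option \<Rightarrow> real" where "g v = (if v = None then 1 else 0)" for v
  have J': "finite J'"
    using J by (simp add: J'_def)
  have sumJ': "(\<Sum>v\<in>J'. f v) = f None + (\<Sum>j\<in>J. f (Some j))" for f :: "'j option \<Rightarrow> real"
    using J by (simp add: J'_def sum.reindex)
  have unit: "(\<Sum>v\<in>J'. (if v = w then - 1 else 0) * x v) = - x w" if "w \<in> J'" for w and x :: "'j option \<Rightarrow> real"
  proof -
    have "(\<Sum>v\<in>J'. (if v = w then - 1 else 0) * x v) = (\<Sum>v\<in>J'. if v = w then - x v else 0)"
      by (intro sum.cong) auto
    then show ?thesis
      using that J' by simp
  qed
  show ?thesis
  proof (cases "\<forall>x. (\<forall>i\<in>I <+> J'. (\<Sum>v\<in>J'. A i v * x v) \<le> 0) \<longrightarrow> (\<Sum>v\<in>J'. g v * x v) \<le> 0")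
    case True
    then obtain u where u: "\<forall>i\<in>I <+> J'. 0 \<le> u i"
      "\<forall>v\<in>J'. g v = (\<Sum>i\<in>I <+> J'. u i * A i v)"
      using farkas[of "I <+> J'" J' A g] I J' by auto
    have col: "g v = (\<Sum>i\<in>I. u (Inl i) * A (Inl i) v) - u (Inr v)" if "v \<in> J'" for v
    proof -
      have "(\<Sum>w\<in>J'. u (Inr w) * A (Inr w) v) = (\<Sum>w\<in>J'. if v = w then - u (Inr w) else 0)"
        by (intro sum.cong) (auto simp: A_def)
      then show ?thesis
        using u(2) that I J' by (simp add: sum.Plus)
    qed
    have "1 = - (\<Sum>i\<in>I. u (Inl i) * b i) - u (Inr None)"
      using col[of None] by (simp add: g_def A_def J'_def sum_negf)
    moreover have "0 = (\<Sum>i\<in>I. u (Inl i) * M i j) - u (Inr (Some j))" if "j \<in> J" for j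
      using col[of "Some j"] that by (simp add: g_def A_def J'_def)
    moreover have "u (Inr v) \<ge> 0" if "v \<in> J'" for v
      using u(1) that by auto
    ultimately show ?thesis
      using u(1) by (intro disjI2 exI[of _ "\<lambda>i. u (Inl i)"]) (force simp: J'_def)
  next
    case False
    then obtain x where x: "\<forall>i\<in>I <+> J'. (\<Sum>v\<in>J'. A i v * x v) \<le> 0" "(\<Sum>v\<in>J'. g v * x v) > 0"
      by (auto simp: not_le)
    have pos: "x None > 0"
      using x(2) by (simp add: sumJ' g_def)
    have nonneg: "x v \<ge> 0" if "v \<in> J'" for v
    proof -
      have "(\<Sum>w\<in>J'. A (Inr v) w * x w) \<le> 0"
        using x(1) that by blast
      then show ?thesis
        using unit[OF that, of x] by (simp add: A_def)
    qed
    have "(\<Sum>j\<in>J. M i j * (x (Some j) / x None)) \<le> b i" if "i \<in> I" for i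
    proof -
      have "(\<Sum>v\<in>J'. A (Inl i) v * x v) \<le> 0"
        using x(1) that by blast
      then have "(\<Sum>j\<in>J. M i j * x (Some j)) \<le> b i * x None"
        by (simp add: sumJ' A_def)
      then show ?thesis
        using pos by (simp add: sum_divide_distrib[symmetric] divide_simps)
    qed
    moreover have "x (Some j) / x None \<ge> 0" if "j \<in> J" for j
      using pos nonneg that by (simp add: J'_def)
    ultimately show ?thesis
      by (intro disjI1 exI[of _ "\<lambda>j. x (Some j) / x None"]) auto
  qed
qed

text \<open>
  Both programs and the comparison of their values are put into one system of inequalities. A
  certificate of its infeasibility consists of multipliers \<open>p\<close>, \<open>q\<close> for the two programs and
  \<open>\<tau>\<close> for the comparison. If \<open>\<tau> > 0\<close>, weak duality for the scaled pair \<open>q / \<tau>\<close>, \<open>p / \<tau>\<close> contradicts it;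
  if \<open>\<tau> = 0\<close>, testing \<open>p\<close> and \<open>q\<close> against the given feasible points does.
\<close>

lemma lp_strong_duality:
  fixes A :: "'i \<Rightarrow> 'j \<Rightarrow> real"
  assumes I: "finite I" and J: "finite J"
    and x0: "\<forall>j\<in>J. 0 \<le> x0 j" "\<forall>i\<in>I. (\<Sum>j\<in>J. A i j * x0 j) \<le> b i"
    and y0: "\<forall>i\<in>I. 0 \<le> y0 i" "\<forall>j\<in>J. c j \<le> (\<Sum>i\<in>I. y0 i * A i j)"
  shows "\<exists>x y. (\<forall>j\<in>J. 0 \<le> x j) \<and> (\<forall>i\<in>I. (\<Sum>j\<in>J. A i j * x j) \<le> b i) \<and>
    (\<forall>i\<in>I. 0 \<le> y i) \<and> (\<forall>j\<in>J. c j \<le> (\<Sum>i\<in>I. y i * A i j)) \<and>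
    (\<Sum>i\<in>I. b i * y i) \<le> (\<Sum>j\<in>J. c j * x j)"
proof -
  \<comment> \<open>Columns are \<open>x\<close> and \<open>y\<close>; the row \<open>None\<close> is \<open>b \<bullet> y - c \<bullet> x \<le> 0\<close>, the others are \<open>A x \<le> b\<close> and \<open>- y A \<le> - c\<close>.\<close>
  define M where "M = case_option (case_sum (\<lambda>j. - c j) b)
    (case_sum (\<lambda>i. case_sum (A i) (\<lambda>_. 0)) (\<lambda>j. case_sum (\<lambda>_. 0) (\<lambda>i. - A i j)))"
  define r where "r = case_option 0 (case_sum b (\<lambda>j. - c j))"
  define R where "R = insert None (Some ` (I <+> J))"
  have R: "None \<in> R" "Some (Inl i) \<in> R \<longleftrightarrow> i \<in> I" "Some (Inr j) \<in> R \<longleftrightarrow> j \<in> J" for i j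
    by (auto simp: R_def)
  have sumR: "(\<Sum>k\<in>R. f k) = f None + (\<Sum>i\<in>I. f (Some (Inl i))) + (\<Sum>j\<in>J. f (Some (Inr j)))"
    for f :: "('i + 'j) option \<Rightarrow> real"
    using I J by (simp add: R_def sum.reindex sum.Plus)
  have sumC: "(\<Sum>v\<in>J <+> I. f v) = (\<Sum>j\<in>J. f (Inl j)) + (\<Sum>i\<in>I. f (Inr i))"
    for f :: "'j + 'i \<Rightarrow> real"
    using I J by (simp add: sum.Plus)
  have "finite R" "finite (J <+> I)"
    using I J by (auto simp: R_def)
  then consider
      (sol) z where "\<forall>v\<in>J <+> I. 0 \<le> z v" "\<forall>k\<in>R. (\<Sum>v\<in>J <+> I. M k v * z v) \<le> r k"
    | (cert) u where "\<forall>k\<in>R. 0 \<le> u k" "\<forall>v\<in>J <+> I. 0 \<le> (\<Sum>k\<in>R. u k * M k v)"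
        "(\<Sum>k\<in>R. u k * r k) < 0"
    using farkas_alternative[of R "J <+> I" M r] by blast
  then show ?thesis
  proof cases
    case sol
    have "(\<Sum>j\<in>J. A i j * z (Inl j)) \<le> b i" if "i \<in> I" for i
      using sol(2)[rule_format, of "Some (Inl i)"] that by (simp add: R sumC M_def r_def)
    moreover have "c j \<le> (\<Sum>i\<in>I. z (Inr i) * A i j)" if "j \<in> J" for j
      using sol(2)[rule_format, of "Some (Inr j)"] that
      by (simp add: R sumC M_def r_def sum_negf mult.commute)
    moreover have "(\<Sum>i\<in>I. b i * z (Inr i)) \<le> (\<Sum>j\<in>J. c j * z (Inl j))"
      using sol(2)[rule_format, of None] by (simp add: R sumC M_def r_def sum_negf)
    ultimately show ?thesis
      using sol(1) by (intro exI[of _ "\<lambda>j. z (Inl j)"] exI[of _ "\<lambda>i. z (Inr i)"]) auto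
  next
    case cert
    define \<tau> where "\<tau> = u None"
    define p where "p i = u (Some (Inl i))" for i
    define q where "q j = u (Some (Inr j))" for j
    have nonneg: "\<tau> \<ge> 0" "\<And>i. i \<in> I \<Longrightarrow> p i \<ge> 0" "\<And>j. j \<in> J \<Longrightarrow> q j \<ge> 0"
      using cert(1) by (auto simp: R \<tau>_def p_def q_def)
    have pA: "\<tau> * c j \<le> (\<Sum>i\<in>I. p i * A i j)" if "j \<in> J" for j
      using cert(2)[rule_format, OF InlI[OF that]] by (simp add: sumR M_def \<tau>_def p_def q_def)
    have Aq: "(\<Sum>j\<in>J. A i j * q j) \<le> \<tau> * b i" if "i \<in> I" for i
      using cert(2)[rule_format, OF InrI[OF that]]
      by (simp add: sumR M_def \<tau>_def p_def q_def sum_negf mult.commute)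
    have less: "(\<Sum>i\<in>I. p i * b i) < (\<Sum>j\<in>J. q j * c j)"
      using cert(3) by (simp add: sumR r_def p_def q_def sum_negf)
    have swap: "(\<Sum>j\<in>J. (\<Sum>i\<in>I. y i * A i j) * x j) = (\<Sum>i\<in>I. y i * (\<Sum>j\<in>J. A i j * x j))" for x y
      unfolding sum_distrib_left sum_distrib_right
      by (subst sum.swap) (simp add: mult.assoc)
    show ?thesis
    proof (cases "\<tau> = 0")
      case True
      have "0 \<le> (\<Sum>j\<in>J. (\<Sum>i\<in>I. p i * A i j) * x0 j)"
        using pA x0 True by (intro sum_nonneg[where A = J] mult_nonneg_nonneg) auto
      also have "\<dots> \<le> (\<Sum>i\<in>I. p i * b i)"
        unfolding swap using x0 nonneg by (intro sum_mono mult_left_mono) auto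
      finally have "0 \<le> (\<Sum>i\<in>I. p i * b i)" .
      moreover have "(\<Sum>j\<in>J. q j * c j) \<le> (\<Sum>j\<in>J. (\<Sum>i\<in>I. y0 i * A i j) * q j)"
        using y0 nonneg by (intro sum_mono) (auto simp: mult.commute[of "q _"] intro: mult_right_mono)
      moreover have "\<dots> \<le> 0"
        unfolding swap using y0 Aq True by (intro sum_nonpos[where A = I] mult_nonneg_nonpos) auto
      ultimately show ?thesis
        using less by linarith
    next
      case False
      have "\<tau> * (\<Sum>j\<in>J. q j * c j) = (\<Sum>j\<in>J. (\<tau> * c j) * q j)"
        by (simp add: sum_distrib_left algebra_simps)
      also have "\<dots> \<le> (\<Sum>j\<in>J. (\<Sum>i\<in>I. p i * A i j) * q j)"
        using pA nonneg by (intro sum_mono mult_right_mono) auto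
      also have "\<dots> \<le> (\<Sum>i\<in>I. p i * (\<tau> * b i))"
        unfolding swap using Aq nonneg by (intro sum_mono mult_left_mono) auto
      also have "\<dots> = \<tau> * (\<Sum>i\<in>I. p i * b i)"
        by (simp add: sum_distrib_left algebra_simps)
      finally show ?thesis
        using less False nonneg by simp
    qed
  qed
qed

section \<open>Conjugation and the tight span\<close>

lemma Dinf_plus_le_iff:
  assumes "finite X"
  shows "Dinf_plus X p q \<le> B \<longleftrightarrow> 0 \<le> B \<and> (\<forall>x\<in>X. q x \<le> p x + B)"
proof -
  have "max (q x - p x) 0 \<le> B \<longleftrightarrow> 0 \<le> B \<and> q x \<le> p x + B" for x
    by auto
  then show ?thesis
    using assms by (auto simp: Dinf_plus_def)
qed

lemma Dinf_le_iff:
  assumes "finite S"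
  shows "Dinf S p q \<le> B \<longleftrightarrow> 0 \<le> B \<and> (\<forall>s\<in>S. q (Inl s) \<le> p (Inl s) + B) \<and>
    (\<forall>s\<in>S. p (Inr s) \<le> q (Inr s) + B)"
  using assms by (simp add: Dinf_def Dinf_plus_le_iff) blast

definition conjugate :: "'a set \<Rightarrow> ('a \<Rightarrow> 'a \<Rightarrow> real) \<Rightarrow> ('a \<Rightarrow> real) \<Rightarrow> 'a \<Rightarrow> real" where
  "conjugate S \<mu> a s = Max (insert 0 ((\<lambda>t. \<mu> s t - a t) ` S))"

text \<open>
  For nonnegative \<open>a\<close> and \<open>b\<close>, this makes \<open>a\<^sup>* \<le> b\<close> equivalent to \<open>\<mu>(s,t) \<le> b(s) + a(t)\<close> for all \<open>s\<close>, \<open>t\<close>. The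
  condition is symmetric in the two vectors, whence the Galois connection.
\<close>

lemma conjugate_le_iff:
  assumes "finite S"
  shows "conjugate S \<mu> a s \<le> B \<longleftrightarrow> 0 \<le> B \<and> (\<forall>t\<in>S. \<mu> s t \<le> a t + B)"
proof -
  have "\<mu> s t - a t \<le> B \<longleftrightarrow> \<mu> s t \<le> a t + B" for t
    by auto
  then show ?thesis
    using assms by (simp add: conjugate_def)
qed

lemma conjugate_nonneg: "finite S \<Longrightarrow> 0 \<le> conjugate S \<mu> a s"
  using conjugate_le_iff[THEN iffD1, OF _ order_refl] by (rule conjunct1)

lemma le_add_conjugate: "finite S \<Longrightarrow> t \<in> S \<Longrightarrow> \<mu> s t \<le> a t + conjugate S \<mu> a s"
  using conjugate_le_iff[THEN iffD1, THEN conjunct2, THEN bspec, OF _ order_refl] .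

lemma conjugate_shift:
  assumes "finite S" "0 \<le> \<delta>" "\<forall>t\<in>S. a t \<le> a' t + \<delta>"
  shows "conjugate S \<mu> a' s \<le> conjugate S \<mu> a s + \<delta>"
  unfolding conjugate_le_iff[OF assms(1)]
proof (intro conjI ballI)
  show "0 \<le> conjugate S \<mu> a s + \<delta>"
    using assms by (intro add_nonneg_nonneg conjugate_nonneg)
  show "\<mu> s t \<le> a' t + (conjugate S \<mu> a s + \<delta>)" if "t \<in> S" for t
    using le_add_conjugate[OF assms(1) that, of \<mu> s a] assms(3) that by fastforce
qed

definition tight_point :: "'a set \<Rightarrow> ('a \<Rightarrow> 'a \<Rightarrow> real) \<Rightarrow> ('a \<Rightarrow> real) \<Rightarrow> 'a + 'a \<Rightarrow> real" where
  "tight_point S \<mu> a =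
     restrict (case_sum (conjugate S \<mu> a) (conjugate S (\<lambda>t s. \<mu> s t) (conjugate S \<mu> a))) (S <+> S)"

text \<open>
  A point \<open>q \<in> P\<^sub>\<mu>\<close> below \<open>(b, d) = (a\<^sup>*, a\<^sup>*\<^sup>*)\<close> satisfies \<open>q\<^sup>r \<ge> (q\<^sup>c)\<^sup>* \<ge> b\<^sup>* = d\<close> because conjugation
  reverses the order, and \<open>q\<^sup>c \<ge> (q\<^sup>r)\<^sup>* \<ge> d\<^sup>* \<ge> a\<^sup>* = b\<close> because also \<open>d \<le> a\<close>.
\<close>

lemma tight_point_in_T_set:
  assumes S: "finite S" and a: "\<forall>t\<in>S. 0 \<le> a t"
  shows "tight_point S \<mu> a \<in> T_set S \<mu>"
proof -
  define b where "b = conjugate S \<mu> a"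
  define d where "d = conjugate S (\<lambda>t s. \<mu> s t) b"
  have p: "tight_point S \<mu> a (Inl s) = b s" "tight_point S \<mu> a (Inr s) = d s" if "s \<in> S" for s
    using that by (auto simp: tight_point_def b_def d_def)
  have d_le_a: "d t \<le> a t" if "t \<in> S" for t
    using le_add_conjugate[OF S that, of \<mu> _ a] a that
    by (auto simp: d_def b_def conjugate_le_iff[OF S] add.commute)
  have "\<mu> s t \<le> b s + d t" if "s \<in> S" for s t
    using le_add_conjugate[OF S that, of "\<lambda>t s. \<mu> s t" t b] by (simp add: d_def)
  then have "tight_point S \<mu> a \<in> P_set S \<mu>"
    using p by (auto simp: P_set_def PiE_iff conjugate_nonneg[OF S] b_def d_def tight_point_def)
  moreover have "q = tight_point S \<mu> a"
    if q: "q \<in> P_set S \<mu>" and le: "\<forall>x\<in>S <+> S. q x \<le> tight_point S \<mu> a x" for q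
  proof -
    have q_nonneg: "0 \<le> q (Inl s)" "0 \<le> q (Inr s)" if "s \<in> S" for s
      using q that by (auto simp: P_set_def PiE_iff)
    have q_sum: "\<mu> s t \<le> q (Inl s) + q (Inr t)" if "s \<in> S" "t \<in> S" for s t
      using q that by (auto simp: P_set_def)
    have le_b: "q (Inl s) \<le> b s" and le_d: "q (Inr s) \<le> d s" if "s \<in> S" for s
      using le[rule_format, OF InlI[OF that]] le[rule_format, OF InrI[OF that]] p[OF that]
      by simp_all
    have ge_d: "d t \<le> q (Inr t)" if "t \<in> S" for t
      unfolding d_def conjugate_le_iff[OF S] using q_nonneg q_sum le_b that
      by (meson add_right_mono order_trans)
    have ge_b: "b s \<le> q (Inl s)" if "s \<in> S" for s
      unfolding b_def conjugate_le_iff[OF S] using q_nonneg q_sum le_d d_le_a that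
      by (smt (verit))
    have "q x = tight_point S \<mu> a x" if "x \<in> S <+> S" for x
      using that p le_b le_d ge_b ge_d by (auto intro: antisym)
    then show ?thesis
      using q by (intro extensionalityI[of _ "S <+> S"]) (auto simp: P_set_def PiE_iff tight_point_def)
  qed
  ultimately show ?thesis
    by (auto simp: T_set_def)
qed

text \<open>
  The direction flips with each conjugation, in agreement with \<open>Dinf\<close>, which measures the
  c-coordinates and the r-coordinates in opposite directions.
\<close>

lemma Dinf_tight_point_le:
  assumes "finite S" "0 \<le> \<delta>" "\<forall>t\<in>S. a t \<le> a' t + \<delta>"
  shows "Dinf S (tight_point S \<mu> a) (tight_point S \<mu> a') \<le> \<delta>"
  using assms by (auto simp: Dinf_le_iff tight_point_def intro!: conjugate_shift)

lemma tight_point_eq_mu_point: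
  assumes S: "finite S" and \<mu>: "directed_metric S \<mu>" and s: "s \<in> S"
    and a: "a s = 0" "\<forall>t\<in>S. \<mu> s t \<le> a t"
  shows "tight_point S \<mu> a = mu_point S \<mu> s"
proof -
  have nonneg: "0 \<le> \<mu> x y" and tri: "\<mu> x z \<le> \<mu> x y + \<mu> y z" and diag: "\<mu> x x = 0"
    if "x \<in> S" "y \<in> S" "z \<in> S" for x y z
    using \<mu> that by (auto simp: directed_metric_def)
  have b: "conjugate S \<mu> a u = \<mu> u s" if u: "u \<in> S" for u
  proof (rule antisym)
    have "\<mu> u t \<le> a t + \<mu> u s" if "t \<in> S" for t
      using tri[OF u s that] a(2) that by fastforce
    then show "conjugate S \<mu> a u \<le> \<mu> u s"
      using nonneg[OF u s s] by (simp add: conjugate_le_iff[OF S])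
    show "\<mu> u s \<le> conjugate S \<mu> a u"
      using le_add_conjugate[OF S s, of \<mu> u a] a(1) by simp
  qed
  have "conjugate S (\<lambda>t s. \<mu> s t) (conjugate S \<mu> a) t = \<mu> s t" if t: "t \<in> S" for t
  proof (rule antisym)
    show "conjugate S (\<lambda>t s. \<mu> s t) (conjugate S \<mu> a) t \<le> \<mu> s t"
      using nonneg[OF s t t] tri[OF _ s t] by (simp add: conjugate_le_iff[OF S] b)
    show "\<mu> s t \<le> conjugate S (\<lambda>t s. \<mu> s t) (conjugate S \<mu> a) t"
      using le_add_conjugate[OF S s, of "\<lambda>t s. \<mu> s t" t "conjugate S \<mu> a"] b[OF s] diag[OF s s s]
      by simp
  qed
  then show ?thesis
    using b by (auto simp: tight_point_def mu_point_def intro!: restrict_ext)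
qed

section \<open>Paths and distances in a network\<close>

text \<open>
  The bound \<open>M\<close> gives a finite value also when \<open>t\<close> cannot be reached from \<open>x\<close>. The length is a sum over
  the set of arcs, so the shortening of a walk to a path visibly does not increase it.
\<close>

definition truncated_distance ::
  "('v, 'e) pre_digraph \<Rightarrow> ('e \<Rightarrow> real) \<Rightarrow> real \<Rightarrow> 'v \<Rightarrow> 'v \<Rightarrow> real" where
  "truncated_distance G l M x t =
     Min (insert M ((\<lambda>P. \<Sum>e\<in>set P. l e) ` {P. pre_digraph.apath G x P t}))"

context fin_digraph
begin

lemma S_path_cases:
  assumes "P \<in> S_paths G S"
  obtains s t where "s \<in> S" "t \<in> S" "apath s P t" "P \<noteq> []" "set P \<subseteq> arcs G" "distinct P"
    "start_vertex G P = s" "end_vertex G P = t"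
proof -
  from assms obtain s t where st: "s \<in> S" "t \<in> S" "s \<noteq> t" "apath s P t"
    by (auto simp: S_paths_def)
  then have ne: "P \<noteq> []"
    by (auto simp: apath_Nil_iff)
  from st have P: "awalk s P t" "distinct P"
    by (auto simp: apath_def intro: distinct_verts_imp_distinct)
  have "awalk_verts s P = map (tail G) P @ [head G (last P)]"
    using ne by (simp add: awalk_verts_conv)
  then have "end_vertex G P = t"
    using awlast_of_awalk[OF P(1)] by (simp add: end_vertex_def)
  moreover have "start_vertex G P = s"
    using P(1) ne by (cases P) (auto simp: start_vertex_def awalk_Cons_iff)
  ultimately show ?thesis
    using that st P ne by (auto simp: awalk_def)
qed

lemma finite_S_paths: "finite (S_paths G S)"
proof (rule finite_subset)
  show "S_paths G S \<subseteq> (fst \<circ> snd) ` {(u, p, v). apath u p v}"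
    by (force simp: S_paths_def image_iff)
qed (use apaths_finite_triple in blast)

lemma le_truncated_distance_iff:
  "B \<le> truncated_distance G l M x t \<longleftrightarrow> B \<le> M \<and> (\<forall>P. apath x P t \<longrightarrow> B \<le> (\<Sum>e\<in>set P. l e))"
  unfolding truncated_distance_def using apaths_finite[of x t] by auto

lemma truncated_distance_self:
  assumes l: "\<forall>e\<in>arcs G. 0 \<le> l e" and "0 \<le> M" "x \<in> verts G"
  shows "truncated_distance G l M x x = 0"
proof (rule antisym)
  show "truncated_distance G l M x x \<le> 0"
    using le_truncated_distance_iff[of "truncated_distance G l M x x" l M x x] assms
    by (force simp: apath_Nil_iff dest: spec[of _ "[]"])
  show "0 \<le> truncated_distance G l M x x"
    using assms by (auto simp: le_truncated_distance_iff apath_def awalk_def intro!: sum_nonneg)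
qed

lemma truncated_distance_arc:
  assumes l: "\<forall>e\<in>arcs G. 0 \<le> l e" and e: "e \<in> arcs G"
  shows "truncated_distance G l M (tail G e) t \<le> truncated_distance G l M (head G e) t + l e"
proof -
  let ?d = "\<lambda>x. truncated_distance G l M x t"
  have d: "?d (tail G e) \<le> M" "\<And>P. apath (tail G e) P t \<Longrightarrow> ?d (tail G e) \<le> (\<Sum>e\<in>set P. l e)"
    using le_truncated_distance_iff[of "?d (tail G e)" l M "tail G e" t] by auto
  have "?d (tail G e) - l e \<le> (\<Sum>e\<in>set P. l e)" if P: "apath (head G e) P t" for P
  proof -
    have walk: "awalk (tail G e) (e # P) t"
      using P e by (auto simp: apath_def awalk_Cons_iff)
    have "?d (tail G e) \<le> (\<Sum>e\<in>set (awalk_to_apath (e # P)). l e)"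
      using walk by (intro d apath_awalk_to_apath)
    also have "\<dots> \<le> (\<Sum>e\<in>set (e # P). l e)"
      using awalk_to_apath_subset[OF walk] walk l by (intro sum_mono2) (auto simp: awalk_def)
    also have "\<dots> \<le> l e + (\<Sum>e\<in>set P. l e)"
      using l e by (auto simp: sum.insert_if)
    finally show ?thesis
      by simp
  qed
  moreover have "?d (tail G e) - l e \<le> M"
    using d(1) l e by fastforce
  ultimately have "?d (tail G e) - l e \<le> ?d (head G e)"
    by (simp add: le_truncated_distance_iff)
  then show ?thesis
    by simp
qed

lemma potential_diff_eq_sum_list:
  fixes f :: "'a \<Rightarrow> real"
  shows "cas u P v \<Longrightarrow> f v - f u = (\<Sum>e\<leftarrow>P. f (head G e) - f (tail G e))"
  by (induction u P v rule: cas.induct) auto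

section \<open>Weak and strong duality for multiflows\<close>

lemma mu_le_sum_Dinf:
  fixes \<mu> :: "'a \<Rightarrow> 'a \<Rightarrow> real"
  assumes S: "finite S" and \<mu>: "directed_metric S \<mu>"
    and \<rho>: "\<forall>s\<in>S. \<rho> s = mu_point S \<mu> s" and P: "P \<in> S_paths G S"
  shows "\<mu> (start_vertex G P) (end_vertex G P) \<le> (\<Sum>e\<in>set P. Dinf S (\<rho> (tail G e)) (\<rho> (head G e)))"
proof -
  from P obtain s t where st: "s \<in> S" "t \<in> S" "apath s P t" "distinct P"
    "start_vertex G P = s" "end_vertex G P = t"
    by (rule S_path_cases)
  \<comment> \<open>the coordinate at the c-copy of the start vertex serves as potential\<close>
  define f where "f v = \<rho> v (Inl s)" for v
  have "\<mu> s t = f t - f s"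
    using st \<mu> \<rho> by (auto simp: f_def mu_point_def directed_metric_def)
  also have "\<dots> = (\<Sum>e\<leftarrow>P. f (head G e) - f (tail G e))"
    using st by (intro potential_diff_eq_sum_list) (auto simp: apath_def awalk_def)
  also have "\<dots> = (\<Sum>e\<in>set P. f (head G e) - f (tail G e))"
    using st by (simp add: sum_list_distinct_conv_sum_set)
  also have "\<dots> \<le> (\<Sum>e\<in>set P. Dinf S (\<rho> (tail G e)) (\<rho> (head G e)))"
  proof (rule sum_mono)
    fix e
    show "f (head G e) - f (tail G e) \<le> Dinf S (\<rho> (tail G e)) (\<rho> (head G e))"
      using Dinf_le_iff[OF S, of "\<rho> (tail G e)" "\<rho> (head G e)"] st(1)
      by (force simp: f_def algebra_simps)
  qed
  finally show ?thesis
    using st by simp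
qed

lemma flow_value_le_cost:
  fixes \<mu> :: "'a \<Rightarrow> 'a \<Rightarrow> real"
  assumes S: "finite S" and \<mu>: "directed_metric S \<mu>"
    and \<rho>: "\<forall>s\<in>S. \<rho> s = mu_point S \<mu> s" and f: "multiflow G S c f"
  shows "flow_value G \<mu> f \<le> (\<Sum>e\<in>arcs G. real (c e) * Dinf S (\<rho> (tail G e)) (\<rho> (head G e)))"
proof -
  obtain \<P> w where "f = (\<P>, w)"
    by fastforce
  then have \<P>: "\<P> \<subseteq> S_paths G S" and w: "\<forall>P\<in>\<P>. 0 \<le> w P"
    and cap: "\<forall>e\<in>arcs G. (\<Sum>P\<in>{P\<in>\<P>. e \<in> set P}. w P) \<le> real (c e)"
    using f by (auto simp: multiflow_def)
  define D where "D e = Dinf S (\<rho> (tail G e)) (\<rho> (head G e))" for e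
  have D: "0 \<le> D e" for e
    unfolding D_def using Dinf_le_iff[OF S] by blast
  have fin: "finite \<P>"
    using \<P> finite_S_paths finite_subset by blast
  have arcs: "{e \<in> arcs G. e \<in> set P} = set P" if "P \<in> \<P>" for P
    using \<P> that by (auto elim: S_path_cases)
  have "flow_value G \<mu> f = (\<Sum>P\<in>\<P>. \<mu> (start_vertex G P) (end_vertex G P) * w P)"
    by (simp add: flow_value_def \<open>f = _\<close>)
  also have "\<dots> \<le> (\<Sum>P\<in>\<P>. (\<Sum>e\<in>set P. D e) * w P)"
    using w mu_le_sum_Dinf[OF S \<mu> \<rho>] \<P> by (intro sum_mono mult_right_mono) (auto simp: D_def)
  also have "\<dots> = (\<Sum>P\<in>\<P>. \<Sum>e\<in>{e\<in>arcs G. e \<in> set P}. D e * w P)"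
    using arcs by (simp add: sum_distrib_right)
  also have "\<dots> = (\<Sum>e\<in>arcs G. \<Sum>P\<in>{P\<in>\<P>. e \<in> set P}. D e * w P)"
    using fin by (intro sum.swap_restrict) auto
  also have "\<dots> = (\<Sum>e\<in>arcs G. (\<Sum>P\<in>{P\<in>\<P>. e \<in> set P}. w P) * D e)"
    by (simp add: sum_distrib_left mult.commute)
  also have "\<dots> \<le> (\<Sum>e\<in>arcs G. real (c e) * D e)"
    using cap D by (intro sum_mono mult_right_mono) auto
  finally show ?thesis
    by (simp add: D_def)
qed

text \<open>
  The dual variables of the capacity constraints are arc lengths, and dual feasibility says that
  every \<open>S\<close>-path is long enough. Feasible dual lengths exist because every \<open>S\<close>-path has an arc.
\<close>

lemma multiflow_lp_duality:
  fixes \<mu> :: "'a \<Rightarrow> 'a \<Rightarrow> real"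
  assumes \<mu>: "directed_metric S \<mu>"
  obtains f l where "multiflow G S c f" "\<forall>e\<in>arcs G. 0 \<le> l e"
    "\<forall>P\<in>S_paths G S. \<mu> (start_vertex G P) (end_vertex G P) \<le> (\<Sum>e\<in>set P. l e)"
    "(\<Sum>e\<in>arcs G. real (c e) * l e) \<le> flow_value G \<mu> f"
proof -
  define \<Q> where "\<Q> = S_paths G S"
  define A :: "'b \<Rightarrow> 'b list \<Rightarrow> real" where "A e P = (if e \<in> set P then 1 else 0)" for e P
  define m where "m P = \<mu> (start_vertex G P) (end_vertex G P)" for P
  have \<Q>: "finite \<Q>"
    unfolding \<Q>_def by (rule finite_S_paths)
  have m: "0 \<le> m P" if "P \<in> \<Q>" for P
    using that \<mu> unfolding \<Q>_def by (elim S_path_cases) (auto simp: m_def directed_metric_def)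
  have flow_through: "(\<Sum>P\<in>\<Q>. A e P * x P) = (\<Sum>P\<in>{P\<in>\<Q>. e \<in> set P}. x P)" for e x
    unfolding sum.inter_filter[OF \<Q>] by (intro sum.cong) (auto simp: A_def)
  have length: "(\<Sum>e\<in>arcs G. y e * A e P) = (\<Sum>e\<in>set P. y e)" if "P \<in> \<Q>" for y P
  proof -
    have "(\<Sum>e\<in>arcs G. y e * A e P) = (\<Sum>e\<in>{e\<in>arcs G. e \<in> set P}. y e)"
      unfolding sum.inter_filter[OF finite_arcs] by (intro sum.cong) (auto simp: A_def)
    also have "{e\<in>arcs G. e \<in> set P} = set P"
      using that unfolding \<Q>_def by (auto elim: S_path_cases)
    finally show ?thesis .
  qed
  define B where "B = (\<Sum>P\<in>\<Q>. m P)"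
  have "B \<ge> 0"
    using m by (auto simp: B_def intro: sum_nonneg)
  have "m P \<le> (\<Sum>e\<in>arcs G. B * A e P)" if P: "P \<in> \<Q>" for P
  proof -
    have "m P \<le> B"
      unfolding B_def using P \<Q> m by (intro member_le_sum) auto
    also have "P \<noteq> []"
      using P unfolding \<Q>_def by (auto elim: S_path_cases)
    then have "B \<le> (\<Sum>e\<in>set P. B)"
      using \<open>B \<ge> 0\<close> by (intro member_le_sum[of "hd P" "set P" "\<lambda>_. B"]) auto
    finally show ?thesis
      using length[OF P, of "\<lambda>_. B"] by simp
  qed
  then have "\<exists>x y. (\<forall>P\<in>\<Q>. 0 \<le> x P) \<and> (\<forall>e\<in>arcs G. (\<Sum>P\<in>\<Q>. A e P * x P) \<le> real (c e)) \<and>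
    (\<forall>e\<in>arcs G. 0 \<le> y e) \<and> (\<forall>P\<in>\<Q>. m P \<le> (\<Sum>e\<in>arcs G. y e * A e P)) \<and>
    (\<Sum>e\<in>arcs G. real (c e) * y e) \<le> (\<Sum>P\<in>\<Q>. m P * x P)"
    using \<open>B \<ge> 0\<close> \<Q> by (intro lp_strong_duality[of _ _ "\<lambda>_. 0" _ _ "\<lambda>_. B"]) auto
  then obtain x y where "\<forall>P\<in>\<Q>. 0 \<le> x P" "\<forall>e\<in>arcs G. (\<Sum>P\<in>\<Q>. A e P * x P) \<le> real (c e)"
    and y: "\<forall>e\<in>arcs G. 0 \<le> y e" "\<forall>P\<in>\<Q>. m P \<le> (\<Sum>e\<in>arcs G. y e * A e P)"
      "(\<Sum>e\<in>arcs G. real (c e) * y e) \<le> (\<Sum>P\<in>\<Q>. m P * x P)"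
    by blast
  then have "multiflow G S c (\<Q>, x)"
    by (simp add: multiflow_def \<Q>_def[symmetric] flow_through)
  then show ?thesis
    using that[of "(\<Q>, x)" y] y length by (simp add: \<Q>_def m_def flow_value_def)
qed

text \<open>
  The map is \<open>x \<mapsto> (a\<^sub>x\<^sup>*, a\<^sub>x\<^sup>*\<^sup>*)\<close> for the truncated distances \<open>a\<^sub>x\<close> to the terminals. The truncation bound
  \<open>M\<close> dominates \<open>\<mu>\<close>, so the truncation respects \<open>\<mu>(s,t) \<le> a\<^sub>s(t)\<close>.
\<close>

lemma tight_span_map_of_lengths:
  fixes \<mu> :: "'a \<Rightarrow> 'a \<Rightarrow> real"
  assumes S: "finite S" "S \<subseteq> verts G" and \<mu>: "directed_metric S \<mu>"
    and l: "\<forall>e\<in>arcs G. 0 \<le> l e"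
    and long: "\<forall>P\<in>S_paths G S. \<mu> (start_vertex G P) (end_vertex G P) \<le> (\<Sum>e\<in>set P. l e)"
  obtains \<rho> where "\<rho> \<in> verts G \<rightarrow> T_set S \<mu>" "\<forall>s\<in>S. \<rho> s = mu_point S \<mu> s"
    "\<forall>e\<in>arcs G. Dinf S (\<rho> (tail G e)) (\<rho> (head G e)) \<le> l e"
proof
  define M where "M = Max (insert 0 ((\<lambda>(s, t). \<mu> s t) ` (S \<times> S)))"
  define a where "a = truncated_distance G l M"
  define \<rho> where "\<rho> x = tight_point S \<mu> (a x)" for x
  have M: "0 \<le> M" "\<And>s t. s \<in> S \<Longrightarrow> t \<in> S \<Longrightarrow> \<mu> s t \<le> M"
    unfolding M_def using S(1) by (auto intro!: Max_ge)
  have nonneg: "0 \<le> a x t" for x t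
    using l M(1)
    by (auto simp: a_def le_truncated_distance_iff apath_def awalk_def intro!: sum_nonneg)
  show "\<rho> \<in> verts G \<rightarrow> T_set S \<mu>"
    using S(1) nonneg by (auto simp: \<rho>_def intro!: tight_point_in_T_set)
  show "\<forall>e\<in>arcs G. Dinf S (\<rho> (tail G e)) (\<rho> (head G e)) \<le> l e"
    unfolding \<rho>_def using l S(1)
    by (auto simp: a_def intro!: Dinf_tight_point_le truncated_distance_arc)
  show "\<forall>s\<in>S. \<rho> s = mu_point S \<mu> s"
  proof
    fix s
    assume s: "s \<in> S"
    have "\<mu> s t \<le> a s t" if t: "t \<in> S" for t
    proof (cases "s = t")
      case True
      then show ?thesis
        using nonneg \<mu> s by (simp add: directed_metric_def)
    next
      case False
      have "\<mu> s t \<le> (\<Sum>e\<in>set P. l e)" if P: "apath s P t" for P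
      proof -
        have SP: "P \<in> S_paths G S"
          using P s t False by (auto simp: S_paths_def)
        then obtain s' t' where "apath s' P t'" "P \<noteq> []"
          "start_vertex G P = s'" "end_vertex G P = t'"
          by (rule S_path_cases)
        moreover from this have "s' = s" "t' = t"
          using awalk_ends[of s P t s' t'] P by (auto simp: apath_def)
        ultimately show ?thesis
          using long SP by auto
      qed
      then show ?thesis
        using M(2)[OF s t] by (simp add: a_def le_truncated_distance_iff)
    qed
    moreover have "a s s = 0"
      unfolding a_def using l M(1) s S(2) by (intro truncated_distance_self) auto
    ultimately show "\<rho> s = mu_point S \<mu> s"
      unfolding \<rho>_def using S(1) \<mu> s by (intro tight_point_eq_mu_point) auto
  qed
qed

end

theorem theorem4p1:
  fixes G :: "('v, 'e) pre_digraph" and S :: "'v set"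
    and c :: "'e \<Rightarrow> nat" and \<mu> :: "'v \<Rightarrow> 'v \<Rightarrow> real"
  assumes "fin_digraph G" and "S \<subseteq> verts G" and "directed_metric S \<mu>"
  shows "\<exists>f \<rho>.
    is_arg_max (flow_value G \<mu>) (multiflow G S c) f \<and>
    is_arg_min (\<lambda>\<rho>. \<Sum>e\<in>arcs G. real (c e) * Dinf S (\<rho> (tail G e)) (\<rho> (head G e)))
      (\<lambda>\<rho>. \<rho> \<in> verts G \<rightarrow> T_set S \<mu> \<and> (\<forall>s\<in>S. \<rho> s = mu_point S \<mu> s)) \<rho> \<and>
    flow_value G \<mu> f = (\<Sum>e\<in>arcs G. real (c e) * Dinf S (\<rho> (tail G e)) (\<rho> (head G e)))"
proof -
  interpret fin_digraph G
    by fact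
  let ?cost = "\<lambda>\<rho>. \<Sum>e\<in>arcs G. real (c e) * Dinf S (\<rho> (tail G e)) (\<rho> (head G e))"
  have S: "finite S"
    using assms(2) finite_verts finite_subset by blast
  obtain f l where f: "multiflow G S c f" and l: "\<forall>e\<in>arcs G. 0 \<le> l e"
    "\<forall>P\<in>S_paths G S. \<mu> (start_vertex G P) (end_vertex G P) \<le> (\<Sum>e\<in>set P. l e)"
    "(\<Sum>e\<in>arcs G. real (c e) * l e) \<le> flow_value G \<mu> f"
    using multiflow_lp_duality[OF assms(3), of c] by blast
  obtain \<rho> where \<rho>: "\<rho> \<in> verts G \<rightarrow> T_set S \<mu>" "\<forall>s\<in>S. \<rho> s = mu_point S \<mu> s"
    and D: "\<forall>e\<in>arcs G. Dinf S (\<rho> (tail G e)) (\<rho> (head G e)) \<le> l e"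
    using tight_span_map_of_lengths[OF S assms(2,3) l(1,2)] by blast
  have weak: "flow_value G \<mu> f' \<le> ?cost \<rho>'"
    if "multiflow G S c f'" "\<forall>s\<in>S. \<rho>' s = mu_point S \<mu> s" for f' \<rho>'
    using flow_value_le_cost[OF S assms(3)] that by blast
  have "?cost \<rho> \<le> (\<Sum>e\<in>arcs G. real (c e) * l e)"
    using D by (intro sum_mono mult_left_mono) auto
  then have eq: "flow_value G \<mu> f = ?cost \<rho>"
    using l(3) weak[OF f \<rho>(2)] by linarith
  moreover have "is_arg_max (flow_value G \<mu>) (multiflow G S c) f"
    using f weak[OF _ \<rho>(2)] eq by (auto simp: is_arg_max_linorder)
  moreover have "is_arg_min ?cost
      (\<lambda>\<rho>. \<rho> \<in> verts G \<rightarrow> T_set S \<mu> \<and> (\<forall>s\<in>S. \<rho> s = mu_point S \<mu> s)) \<rho>"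
    using \<rho> weak[OF f] eq by (auto simp: is_arg_min_linorder)
  ultimately show ?thesis
    by blast
qed

end
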